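(* Let $k$ be a field, $C$ a coalgebra over $k$, $M$ a left $C$-comodule, and $\chi\in C^\ast$. Define linear maps $T:M\to M$ and $P:C\to C$ by $T(m)=\chi(m_{(-1)})m_{(0)}$ and $P(c)=\chi(c_1)c_2$ for $m\in M$, $c\in C$. If $\chi$ is idempotent under the convolution product of $C^\ast$, then $(M,P,T)$ is a Rota-Baxter paired $C$-comodule of weight $-1$.
   Context: All spaces, maps and tensor products are over $k$; $C^\ast$ is the linear dual. Sweedler notation: $\Delta(c)=c_1\otimes c_2$, and the left coaction is $\rho(m)=m_{(-1)}\otimes m_{(0)}\in C\otimes M$. Idempotent under convolution means $\chi(c_1)\chi(c_2)=\chi(c)$ for all $c\in C$. For linear maps $P:C\to C$, $T:M\to M$, the triple $(M,P,T)$ is a Rota-Baxter paired (left) $C$-comodule of weight $\lambda\in k$ if $$(P\otimes T)\rho=(P\otimes \mathrm{id})\rho T+(\mathrm{id}\otimes T)\rho T+\lambda\rho T.$$ *)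

theory Defs
  imports "HOL-Algebra.Module" "HOL-Algebra.AbelCoset"
begin

section \<open>Linear maps, free modules and quotient modules\<close>

text \<open>
  The record type \<^typ>\<open>('k, 'a) module\<close> extends the record of rings. For modules the fields
  \<open>mult\<close> and \<open>one\<close> are meaningless, so they are left \<open>undefined\<close>. Maps between modules
  are only relevant on the carrier.
\<close>

definition module_hom ::
  "('k, 'r) ring_scheme \<Rightarrow> ('k, 'a, 's) module_scheme \<Rightarrow> ('k, 'b, 't) module_scheme
    \<Rightarrow> ('a \<Rightarrow> 'b) set"
  where "module_hom K A B =
    {f \<in> carrier A \<rightarrow> carrier B.
       (\<forall>x\<in>carrier A. \<forall>y\<in>carrier A. f (x \<oplus>\<^bsub>A\<^esub> y) = f x \<oplus>\<^bsub>B\<^esub> f y) \<and>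
       (\<forall>r\<in>carrier K. \<forall>x\<in>carrier A. f (r \<odot>\<^bsub>A\<^esub> x) = r \<odot>\<^bsub>B\<^esub> f x)}"

definition scalar_module :: "('k, 'r) ring_scheme \<Rightarrow> ('k, 'k) module"
  where "scalar_module K =
    \<lparr>carrier = carrier K, mult = undefined, one = undefined,
     zero = \<zero>\<^bsub>K\<^esub>, add = (\<oplus>\<^bsub>K\<^esub>), smult = (\<otimes>\<^bsub>K\<^esub>)\<rparr>"

definition linear_dual ::
  "('k, 'r) ring_scheme \<Rightarrow> ('k, 'a, 's) module_scheme \<Rightarrow> ('a \<Rightarrow> 'k) set"
  where "linear_dual K A = module_hom K A (scalar_module K)"

definition free_module :: "('k, 'r) ring_scheme \<Rightarrow> 'x set \<Rightarrow> ('k, 'x \<Rightarrow> 'k) module"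
  where "free_module K X =
    \<lparr>carrier = {u. (\<forall>x\<in>X. u x \<in> carrier K) \<and> (\<forall>x. x \<notin> X \<longrightarrow> u x = \<zero>\<^bsub>K\<^esub>) \<and>
                   finite {x. u x \<noteq> \<zero>\<^bsub>K\<^esub>}},
     mult = undefined, one = undefined,
     zero = (\<lambda>_. \<zero>\<^bsub>K\<^esub>), add = (\<lambda>u v x. u x \<oplus>\<^bsub>K\<^esub> v x), smult = (\<lambda>r u x. r \<otimes>\<^bsub>K\<^esub> u x)\<rparr>"

definition free_gen :: "('k, 'r) ring_scheme \<Rightarrow> 'x \<Rightarrow> 'x \<Rightarrow> 'k"
  where "free_gen K x = (\<lambda>y. if y = x then \<one>\<^bsub>K\<^esub> else \<zero>\<^bsub>K\<^esub>)"

definition free_lift ::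
  "('k, 'r) ring_scheme \<Rightarrow> ('k, 'n, 's) module_scheme \<Rightarrow> ('x \<Rightarrow> 'n) \<Rightarrow> ('x \<Rightarrow> 'k) \<Rightarrow> 'n"
  where "free_lift K N f u = (\<Oplus>\<^bsub>N\<^esub>x\<in>{x. u x \<noteq> \<zero>\<^bsub>K\<^esub>}. u x \<odot>\<^bsub>N\<^esub> f x)"

definition quotient_module ::
  "('k, 'a, 's) module_scheme \<Rightarrow> 'a set \<Rightarrow> ('k, 'a set) module"
  where "quotient_module M N =
    \<lparr>carrier = a_rcosets\<^bsub>M\<^esub> N, mult = undefined, one = undefined,
     zero = N, add = set_add M, smult = (\<lambda>r X. \<Union>x\<in>X. N +>\<^bsub>M\<^esub> (r \<odot>\<^bsub>M\<^esub> x))\<rparr>"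


section \<open>Tensor products\<close>

text \<open>
  \<open>A \<otimes> B\<close> is the free module on \<open>carrier A \<times> carrier B\<close> modulo the submodule
  generated by the bilinearity relations.
\<close>

definition tensor_free ::
  "('k, 'r) ring_scheme \<Rightarrow> ('k, 'a, 's) module_scheme \<Rightarrow> ('k, 'b, 't) module_scheme
    \<Rightarrow> ('k, 'a \<times> 'b \<Rightarrow> 'k) module"
  where "tensor_free K A B = free_module K (carrier A \<times> carrier B)"

definition bilinear_relations ::
  "('k, 'r) ring_scheme \<Rightarrow> ('k, 'a, 's) module_scheme \<Rightarrow> ('k, 'b, 't) module_scheme
    \<Rightarrow> ('a \<times> 'b \<Rightarrow> 'k) set"
  where "bilinear_relations K A B = (let F = tensor_free K A B; e = (\<lambda>a b. free_gen K (a, b)) in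
      {e (a \<oplus>\<^bsub>A\<^esub> a') b \<ominus>\<^bsub>F\<^esub> (e a b \<oplus>\<^bsub>F\<^esub> e a' b) | a a' b.
         a \<in> carrier A \<and> a' \<in> carrier A \<and> b \<in> carrier B}
    \<union> {e a (b \<oplus>\<^bsub>B\<^esub> b') \<ominus>\<^bsub>F\<^esub> (e a b \<oplus>\<^bsub>F\<^esub> e a b') | a b b'.
         a \<in> carrier A \<and> b \<in> carrier B \<and> b' \<in> carrier B}
    \<union> {e (r \<odot>\<^bsub>A\<^esub> a) b \<ominus>\<^bsub>F\<^esub> (r \<odot>\<^bsub>F\<^esub> e a b) | r a b.
         r \<in> carrier K \<and> a \<in> carrier A \<and> b \<in> carrier B}
    \<union> {e a (r \<odot>\<^bsub>B\<^esub> b) \<ominus>\<^bsub>F\<^esub> (r \<odot>\<^bsub>F\<^esub> e a b) | r a b.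
         r \<in> carrier K \<and> a \<in> carrier A \<and> b \<in> carrier B})"

definition tensor_null ::
  "('k, 'r) ring_scheme \<Rightarrow> ('k, 'a, 's) module_scheme \<Rightarrow> ('k, 'b, 't) module_scheme
    \<Rightarrow> ('a \<times> 'b \<Rightarrow> 'k) set"
  where "tensor_null K A B =
    \<Inter>{N. submodule N K (tensor_free K A B) \<and> bilinear_relations K A B \<subseteq> N}"

definition tensor ::
  "('k, 'r) ring_scheme \<Rightarrow> ('k, 'a, 's) module_scheme \<Rightarrow> ('k, 'b, 't) module_scheme
    \<Rightarrow> ('k, ('a \<times> 'b \<Rightarrow> 'k) set) module"
  where "tensor K A B = quotient_module (tensor_free K A B) (tensor_null K A B)"

definition pure_tensor ::
  "('k, 'r) ring_scheme \<Rightarrow> ('k, 'a, 's) module_scheme \<Rightarrow> ('k, 'b, 't) module_scheme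
    \<Rightarrow> 'a \<Rightarrow> 'b \<Rightarrow> ('a \<times> 'b \<Rightarrow> 'k) set"
  where "pure_tensor K A B a b = tensor_null K A B +>\<^bsub>tensor_free K A B\<^esub> free_gen K (a, b)"

text \<open>
  \<open>tensor_lift K N f\<close> is the linear map \<open>A \<otimes> B \<rightarrow> N\<close> induced by a bilinear map
  \<open>f : A \<times> B \<rightarrow> N\<close>. It is computed on a representative; for bilinear \<open>f\<close> the value
  does not depend on the choice, see \<open>tensor_lift_pure\<close> and \<open>tensor_lift_hom\<close> below.
  In Sweedler notation, \<open>tensor_lift K N f (\<Delta> c)\<close> is \<open>f c\<^sub>1 c\<^sub>2\<close>.
\<close>

definition tensor_lift ::
  "('k, 'r) ring_scheme \<Rightarrow> ('k, 'n, 's) module_scheme \<Rightarrow> ('a \<Rightarrow> 'b \<Rightarrow> 'n)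
    \<Rightarrow> ('a \<times> 'b \<Rightarrow> 'k) set \<Rightarrow> 'n"
  where "tensor_lift K N f X = free_lift K N (\<lambda>(a, b). f a b) (SOME u. u \<in> X)"

text \<open>\<open>tensor_map K A' B' f g\<close> is \<open>f \<otimes> g\<close> with codomain \<open>A' \<otimes> B'\<close>.\<close>

definition tensor_map ::
  "('k, 'r) ring_scheme \<Rightarrow> ('k, 'c, 's) module_scheme \<Rightarrow> ('k, 'd, 't) module_scheme
    \<Rightarrow> ('a \<Rightarrow> 'c) \<Rightarrow> ('b \<Rightarrow> 'd) \<Rightarrow> ('a \<times> 'b \<Rightarrow> 'k) set \<Rightarrow> ('c \<times> 'd \<Rightarrow> 'k) set"
  where "tensor_map K A' B' f g =
    tensor_lift K (tensor K A' B') (\<lambda>a b. pure_tensor K A' B' (f a) (g b))"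

text \<open>The canonical isomorphism \<open>(A \<otimes> B) \<otimes> D \<rightarrow> A \<otimes> (B \<otimes> D)\<close>.\<close>

definition tensor_assoc ::
  "('k, 'r) ring_scheme \<Rightarrow> ('k, 'a, 's) module_scheme \<Rightarrow> ('k, 'b, 't) module_scheme
    \<Rightarrow> ('k, 'd, 'u) module_scheme
    \<Rightarrow> (('a \<times> 'b \<Rightarrow> 'k) set \<times> 'd \<Rightarrow> 'k) set \<Rightarrow> ('a \<times> ('b \<times> 'd \<Rightarrow> 'k) set \<Rightarrow> 'k) set"
  where "tensor_assoc K A B D =
    tensor_lift K (tensor K A (tensor K B D)) (\<lambda>x d.
      tensor_lift K (tensor K A (tensor K B D)) (\<lambda>a b.
        pure_tensor K A (tensor K B D) a (pure_tensor K B D b d)) x)"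


subsection \<open>The induced map of a bilinear map is well defined\<close>

definition bilinear_map ::
  "('k, 'r) ring_scheme \<Rightarrow> ('k, 'a, 's) module_scheme \<Rightarrow> ('k, 'b, 't) module_scheme
    \<Rightarrow> ('k, 'n, 'u) module_scheme \<Rightarrow> ('a \<Rightarrow> 'b \<Rightarrow> 'n) \<Rightarrow> bool"
  where "bilinear_map K A B N f \<longleftrightarrow>
     (\<forall>a\<in>carrier A. f a \<in> module_hom K B N) \<and>
     (\<forall>b\<in>carrier B. (\<lambda>a. f a b) \<in> module_hom K A N)"

lemma free_module_carrier:
  "u \<in> carrier (free_module K X) \<longleftrightarrow> (\<forall>x\<in>X. u x \<in> carrier K) \<and> (\<forall>x. x \<notin> X \<longrightarrow> u x = \<zero>\<^bsub>K\<^esub>) \<and>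
                   finite {x. u x \<noteq> \<zero>\<^bsub>K\<^esub>}"
  by (simp add: free_module_def)

lemma free_module_simps [simp]:
  "\<zero>\<^bsub>free_module K X\<^esub> = (\<lambda>_. \<zero>\<^bsub>K\<^esub>)"
  "u \<oplus>\<^bsub>free_module K X\<^esub> v = (\<lambda>x. u x \<oplus>\<^bsub>K\<^esub> v x)"
  "r \<odot>\<^bsub>free_module K X\<^esub> u = (\<lambda>x. r \<otimes>\<^bsub>K\<^esub> u x)"
  by (simp_all add: free_module_def)

lemma (in cring) free_val: "u \<in> carrier (free_module R X) \<Longrightarrow> u x \<in> carrier R"
  by (cases "x \<in> X") (auto simp: free_module_carrier)

lemma (in cring) free_module_module: "module R (free_module R X)"
proof -
  let ?F = "free_module R X"
  have fin2: "finite {x. u x \<oplus> v x \<noteq> \<zero>}" if "u \<in> carrier ?F" "v \<in> carrier ?F" for u v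
    by (rule finite_subset[of _ "{x. u x \<noteq> \<zero>} \<union> {x. v x \<noteq> \<zero>}"])
       (use that in \<open>auto simp: free_module_carrier\<close>)
  have fin1: "finite {x. r \<otimes> u x \<noteq> \<zero>}" if "u \<in> carrier ?F" "r \<in> carrier R" for u r
    by (rule finite_subset[of _ "{x. u x \<noteq> \<zero>}"])
       (use that in \<open>auto simp: free_module_carrier\<close>)
  have neg: "\<exists>y\<in>carrier ?F. y \<oplus>\<^bsub>?F\<^esub> u = \<zero>\<^bsub>?F\<^esub>" if u: "u \<in> carrier ?F" for u
  proof -
    have "(\<lambda>x. (\<ominus> \<one>) \<otimes> u x) \<in> carrier ?F"
      using u fin1[OF u, of "\<ominus> \<one>"] by (auto simp: free_module_carrier)
    moreover have "(\<ominus> \<one>) \<otimes> u x \<oplus> u x = \<zero>" for x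
      using free_val[OF u, of x] by (simp add: l_minus l_neg)
    ultimately show ?thesis by (intro bexI[of _ "\<lambda>x. (\<ominus> \<one>) \<otimes> u x"]) auto
  qed
  show ?thesis
  proof (rule moduleI)
    show "cring R" by (rule is_cring)
    show "abelian_group ?F"
    proof (rule abelian_groupI)
      fix x y assume "x \<in> carrier ?F" "y \<in> carrier ?F"
      then show "x \<oplus>\<^bsub>?F\<^esub> y \<in> carrier ?F"
        using fin2[of x y] by (auto simp: free_module_carrier)
    next
      show "\<And>x. x \<in> carrier ?F \<Longrightarrow> \<exists>y\<in>carrier ?F. y \<oplus>\<^bsub>?F\<^esub> x = \<zero>\<^bsub>?F\<^esub>" by (rule neg)
        next
      fix x y z assume "x \<in> carrier ?F" "y \<in> carrier ?F" "z \<in> carrier ?F"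
      then show "x \<oplus>\<^bsub>?F\<^esub> y \<oplus>\<^bsub>?F\<^esub> z = x \<oplus>\<^bsub>?F\<^esub> (y \<oplus>\<^bsub>?F\<^esub> z)"
        using free_val[of x X] free_val[of y X] free_val[of z X] by (auto simp: a_assoc fun_eq_iff)
    next
      fix x y assume "x \<in> carrier ?F" "y \<in> carrier ?F"
      then show "x \<oplus>\<^bsub>?F\<^esub> y = y \<oplus>\<^bsub>?F\<^esub> x"
        using free_val[of x X] free_val[of y X] by (auto simp: a_comm fun_eq_iff)
    next
      fix x assume "x \<in> carrier ?F"
      then show "\<zero>\<^bsub>?F\<^esub> \<oplus>\<^bsub>?F\<^esub> x = x"
        using free_val[of x X] by (auto simp: fun_eq_iff)
    qed (simp add: free_module_carrier)
  next
    fix a x assume "a \<in> carrier R" "x \<in> carrier ?F"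
    then show "a \<odot>\<^bsub>?F\<^esub> x \<in> carrier ?F" using fin1[of x a] by (auto simp: free_module_carrier)
  next
    fix a b x assume "a \<in> carrier R" "b \<in> carrier R" "x \<in> carrier ?F"
    then show "(a \<oplus> b) \<odot>\<^bsub>?F\<^esub> x = a \<odot>\<^bsub>?F\<^esub> x \<oplus>\<^bsub>?F\<^esub> b \<odot>\<^bsub>?F\<^esub> x"
     and "(a \<otimes> b) \<odot>\<^bsub>?F\<^esub> x = a \<odot>\<^bsub>?F\<^esub> (b \<odot>\<^bsub>?F\<^esub> x)"
      using free_val[of x X] by (auto simp: l_distr m_assoc fun_eq_iff)
  next
    fix a x y assume "a \<in> carrier R" "x \<in> carrier ?F" "y \<in> carrier ?F"
    then show "a \<odot>\<^bsub>?F\<^esub> (x \<oplus>\<^bsub>?F\<^esub> y) = a \<odot>\<^bsub>?F\<^esub> x \<oplus>\<^bsub>?F\<^esub> a \<odot>\<^bsub>?F\<^esub> y"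
      using free_val[of x X] free_val[of y X] by (auto simp: r_distr fun_eq_iff)
  next
    fix x assume "x \<in> carrier ?F"
    then show "\<one> \<odot>\<^bsub>?F\<^esub> x = x"
      using free_val[of x X] by (auto simp: fun_eq_iff)
  qed
qed

lemma (in cring) free_gen_closed: "x \<in> X \<Longrightarrow> free_gen R x \<in> carrier (free_module R X)"
  by (auto simp: free_module_carrier free_gen_def)

lemma free_lift_superset:
  assumes N: "module K N" and f: "f \<in> X \<rightarrow> carrier N" and u: "u \<in> carrier (free_module K X)"
    and S: "finite S" "{x. u x \<noteq> \<zero>\<^bsub>K\<^esub>} \<subseteq> S" "S \<subseteq> X"
  shows "free_lift K N f u = (\<Oplus>\<^bsub>N\<^esub>x\<in>S. u x \<odot>\<^bsub>N\<^esub> f x)"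
proof -
  interpret module K N by fact
  show ?thesis unfolding free_lift_def
    by (rule M.add.finprod_mono_neutral_cong_left)
       (use S f u in \<open>auto simp: free_module_carrier Pi_iff subset_iff\<close>)
qed

lemma supp_subset: "u \<in> carrier (free_module K X) \<Longrightarrow> {x. u x \<noteq> \<zero>\<^bsub>K\<^esub>} \<subseteq> X"
  by (auto simp: free_module_carrier)

lemma free_lift_hom:
  assumes N: "module K N" and f: "f \<in> X \<rightarrow> carrier N"
  shows "free_lift K N f \<in> module_hom K (free_module K X) N"
proof -
  interpret N: module K N by fact
  let ?F = "free_module K X"
  interpret F: module K ?F by (rule N.R.free_module_module)
  have mem: "u x \<odot>\<^bsub>N\<^esub> f x \<in> carrier N" if "u \<in> carrier ?F" "x \<in> X" for u x
    using that f N.R.free_val[of u X x] by auto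
  have "free_lift K N f u \<in> carrier N" if "u \<in> carrier ?F" for u
    unfolding free_lift_def
    by (rule N.M.finsum_closed) (use mem that supp_subset[OF that] in blast)
  moreover have "free_lift K N f (u \<oplus>\<^bsub>?F\<^esub> v) = free_lift K N f u \<oplus>\<^bsub>N\<^esub> free_lift K N f v"
    if u: "u \<in> carrier ?F" and v: "v \<in> carrier ?F" for u v
  proof -
    define S where "S = {x. u x \<noteq> \<zero>\<^bsub>K\<^esub>} \<union> {x. v x \<noteq> \<zero>\<^bsub>K\<^esub>}"
    have S: "finite S" "S \<subseteq> X" using u v by (auto simp: S_def free_module_carrier)
    have uv: "u \<oplus>\<^bsub>?F\<^esub> v \<in> carrier ?F" using u v by (rule F.M.a_closed)
    have "free_lift K N f (u \<oplus>\<^bsub>?F\<^esub> v) = (\<Oplus>\<^bsub>N\<^esub>x\<in>S. (u \<oplus>\<^bsub>?F\<^esub> v) x \<odot>\<^bsub>N\<^esub> f x)"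
      by (rule free_lift_superset[OF N f uv]) (use S in \<open>auto simp: S_def\<close>)
    also have "\<dots> = (\<Oplus>\<^bsub>N\<^esub>x\<in>S. u x \<odot>\<^bsub>N\<^esub> f x \<oplus>\<^bsub>N\<^esub> v x \<odot>\<^bsub>N\<^esub> f x)"
      by (rule N.M.finsum_cong') (use mem[OF u] mem[OF v] S f N.R.free_val[OF u] N.R.free_val[OF v] in \<open>auto simp: N.smult_l_distr subset_iff Pi_iff\<close>)
    also have "\<dots> = (\<Oplus>\<^bsub>N\<^esub>x\<in>S. u x \<odot>\<^bsub>N\<^esub> f x) \<oplus>\<^bsub>N\<^esub> (\<Oplus>\<^bsub>N\<^esub>x\<in>S. v x \<odot>\<^bsub>N\<^esub> f x)"
      by (rule N.M.finsum_addf) (use mem[OF u] mem[OF v] S in auto)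
    also have "\<dots> = free_lift K N f u \<oplus>\<^bsub>N\<^esub> free_lift K N f v"
      using free_lift_superset[OF N f u S(1) _ S(2)] free_lift_superset[OF N f v S(1) _ S(2)]
      by (auto simp: S_def)
    finally show ?thesis .
  qed
  moreover have "free_lift K N f (r \<odot>\<^bsub>?F\<^esub> u) = r \<odot>\<^bsub>N\<^esub> free_lift K N f u"
    if u: "u \<in> carrier ?F" and r: "r \<in> carrier K" for u r
  proof -
    define S where "S = {x. u x \<noteq> \<zero>\<^bsub>K\<^esub>}"
    have S: "finite S" "S \<subseteq> X" using u by (auto simp: S_def free_module_carrier)
    have ru: "r \<odot>\<^bsub>?F\<^esub> u \<in> carrier ?F" using r u by (rule F.smult_closed)
    have "free_lift K N f (r \<odot>\<^bsub>?F\<^esub> u) = (\<Oplus>\<^bsub>N\<^esub>x\<in>S. (r \<odot>\<^bsub>?F\<^esub> u) x \<odot>\<^bsub>N\<^esub> f x)"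
      by (rule free_lift_superset[OF N f ru]) (use S r in \<open>auto simp: S_def\<close>)
    also have "\<dots> = (\<Oplus>\<^bsub>N\<^esub>x\<in>S. r \<odot>\<^bsub>N\<^esub> (u x \<odot>\<^bsub>N\<^esub> f x))"
      by (rule N.M.finsum_cong') (use mem[OF u] S f N.R.free_val[OF u] r in \<open>auto simp: N.smult_assoc1 subset_iff Pi_iff\<close>)
    also have "\<dots> = r \<odot>\<^bsub>N\<^esub> (\<Oplus>\<^bsub>N\<^esub>x\<in>S. u x \<odot>\<^bsub>N\<^esub> f x)"
      by (rule N.finsum_smult_ldistr[symmetric]) (use mem[OF u] S r in auto)
    finally show ?thesis by (simp add: free_lift_def S_def)
  qed
  ultimately show ?thesis unfolding module_hom_def by blast
qed

lemma free_lift_gen: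
  assumes N: "module K N" and f: "f \<in> X \<rightarrow> carrier N" and x: "x \<in> X"
  shows "free_lift K N f (free_gen K x) = f x"
proof -
  interpret N: module K N by fact
  have "free_lift K N f (free_gen K x) = (\<Oplus>\<^bsub>N\<^esub>y\<in>{x}. free_gen K x y \<odot>\<^bsub>N\<^esub> f y)"
    by (rule free_lift_superset[OF N f N.R.free_gen_closed[OF x]]) (use x in \<open>auto simp: free_gen_def\<close>)
  also have "\<dots> = f x" using x f by (auto simp: free_gen_def Pi_iff)
  finally show ?thesis .
qed

lemma quotient_module_simps [simp]:
  "carrier (quotient_module M N) = a_rcosets\<^bsub>M\<^esub> N"
  "\<zero>\<^bsub>quotient_module M N\<^esub> = N"
  "X \<oplus>\<^bsub>quotient_module M N\<^esub> Y = X <+>\<^bsub>M\<^esub> Y"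
  "r \<odot>\<^bsub>quotient_module M N\<^esub> X = (\<Union>x\<in>X. N +>\<^bsub>M\<^esub> (r \<odot>\<^bsub>M\<^esub> x))"
  by (simp_all add: quotient_module_def)

lemma quotient_module_facts:
  assumes M: "module K M" and N: "submodule N K M"
  shows "module K (quotient_module M N)"
    and "(\<lambda>x. N +>\<^bsub>M\<^esub> x) \<in> module_hom K M (quotient_module M N)"
proof -
  interpret M: module K M by fact
  interpret N: submodule N K M by fact
  interpret S: abelian_subgroup N M
    by (rule abelian_subgroupI3) (auto intro: additive_subgroup.intro N.subgroup_axioms M.M.abelian_group_axioms)
  let ?Q = "quotient_module M N"
  have sm: "r \<odot>\<^bsub>?Q\<^esub> (N +>\<^bsub>M\<^esub> x) = N +>\<^bsub>M\<^esub> (r \<odot>\<^bsub>M\<^esub> x)"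
    if r: "r \<in> carrier K" and x: "x \<in> carrier M" for r x
  proof -
    have "N +>\<^bsub>M\<^esub> (r \<odot>\<^bsub>M\<^esub> y) = N +>\<^bsub>M\<^esub> (r \<odot>\<^bsub>M\<^esub> x)" if y: "y \<in> N +>\<^bsub>M\<^esub> x" for y
    proof -
      from y obtain n where n: "n \<in> N" "y = n \<oplus>\<^bsub>M\<^esub> x" by (auto simp: a_r_coset_defs)
      have "r \<odot>\<^bsub>M\<^esub> y = r \<odot>\<^bsub>M\<^esub> n \<oplus>\<^bsub>M\<^esub> r \<odot>\<^bsub>M\<^esub> x"
        using n r x S.a_subset by (auto simp: M.smult_r_distr)
      then have "r \<odot>\<^bsub>M\<^esub> y \<in> N +>\<^bsub>M\<^esub> (r \<odot>\<^bsub>M\<^esub> x)"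
        using n r by (auto simp: a_r_coset_defs)
      then show ?thesis using S.a_repr_independence'[of "r \<odot>\<^bsub>M\<^esub> y" "r \<odot>\<^bsub>M\<^esub> x"] r x by simp
    qed
    then have "r \<odot>\<^bsub>?Q\<^esub> (N +>\<^bsub>M\<^esub> x) = (\<Union>y\<in>N +>\<^bsub>M\<^esub> x. N +>\<^bsub>M\<^esub> (r \<odot>\<^bsub>M\<^esub> x))"
      unfolding quotient_module_simps by (rule SUP_cong[OF refl])
    moreover have "x \<in> N +>\<^bsub>M\<^esub> x" using x by (rule S.a_rcos_self)
    ultimately show ?thesis by (metis UN_constant empty_iff)
  qed
  have add: "(N +>\<^bsub>M\<^esub> x) \<oplus>\<^bsub>?Q\<^esub> (N +>\<^bsub>M\<^esub> y) = N +>\<^bsub>M\<^esub> (x \<oplus>\<^bsub>M\<^esub> y)"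
    if "x \<in> carrier M" "y \<in> carrier M" for x y
    using that by (simp add: S.a_rcos_sum)
  have rep: "\<exists>x\<in>carrier M. X = N +>\<^bsub>M\<^esub> x" if "X \<in> carrier ?Q" for X
    using that by (auto simp: A_RCOSETS_def RCOSETS_def a_r_coset_def)
  have mem: "N +>\<^bsub>M\<^esub> x \<in> carrier ?Q" if "x \<in> carrier M" for x
    using that by (simp add: M.M.a_rcosetsI S.a_subset)
  have zero: "\<zero>\<^bsub>?Q\<^esub> = N +>\<^bsub>M\<^esub> \<zero>\<^bsub>M\<^esub>"
    using S.a_subset by (simp add: M.M.a_coset_add_zero)
  show "module K ?Q"
  proof (rule moduleI)
    show "cring K" by (rule M.R.is_cring)
    show "abelian_group ?Q"
    proof (rule abelian_groupI)
      fix X assume "X \<in> carrier ?Q"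
      then obtain x where x: "x \<in> carrier M" "X = N +>\<^bsub>M\<^esub> x" using rep by blast
      show "\<exists>Y\<in>carrier ?Q. Y \<oplus>\<^bsub>?Q\<^esub> X = \<zero>\<^bsub>?Q\<^esub>"
        apply (rule bexI[of _ "N +>\<^bsub>M\<^esub> (\<ominus>\<^bsub>M\<^esub> x)"])
         apply (simp only: x zero add M.M.a_inv_closed M.M.l_neg)
        apply (rule mem) using x by simp
      show "\<zero>\<^bsub>?Q\<^esub> \<oplus>\<^bsub>?Q\<^esub> X = X" 
        by (simp only: x zero add M.M.zero_closed M.M.l_zero)
    next
      show "\<zero>\<^bsub>?Q\<^esub> \<in> carrier ?Q" unfolding zero by (rule mem) simp
    next
      fix X Y assume "X \<in> carrier ?Q" "Y \<in> carrier ?Q"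
      then obtain x y where x: "x \<in> carrier M" "X = N +>\<^bsub>M\<^esub> x" "y \<in> carrier M" "Y = N +>\<^bsub>M\<^esub> y" using rep by blast
      show "X \<oplus>\<^bsub>?Q\<^esub> Y \<in> carrier ?Q" unfolding x by (simp only: add x) (rule mem, use x in simp)
      show "X \<oplus>\<^bsub>?Q\<^esub> Y = Y \<oplus>\<^bsub>?Q\<^esub> X" unfolding x by (simp only: add x M.M.a_comm)
      fix Z assume "Z \<in> carrier ?Q"
      then obtain z where z: "z \<in> carrier M" "Z = N +>\<^bsub>M\<^esub> z" using rep by blast
      show "X \<oplus>\<^bsub>?Q\<^esub> Y \<oplus>\<^bsub>?Q\<^esub> Z = X \<oplus>\<^bsub>?Q\<^esub> (Y \<oplus>\<^bsub>?Q\<^esub> Z)"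
        unfolding x z by (simp only: add x z M.M.a_closed M.M.a_assoc)
    qed
  next
    fix a X assume a: "a \<in> carrier K" and "X \<in> carrier ?Q"
    then obtain x where x: "x \<in> carrier M" "X = N +>\<^bsub>M\<^esub> x" using rep by blast
    show "a \<odot>\<^bsub>?Q\<^esub> X \<in> carrier ?Q" unfolding x by (simp only: sm x a) (rule mem, use x a in simp)
    fix b assume b: "b \<in> carrier K"
    show "(a \<oplus>\<^bsub>K\<^esub> b) \<odot>\<^bsub>?Q\<^esub> X = a \<odot>\<^bsub>?Q\<^esub> X \<oplus>\<^bsub>?Q\<^esub> b \<odot>\<^bsub>?Q\<^esub> X"
      unfolding x by (simp only: sm x a b M.R.a_closed add M.smult_closed M.smult_l_distr)
    show "(a \<otimes>\<^bsub>K\<^esub> b) \<odot>\<^bsub>?Q\<^esub> X = a \<odot>\<^bsub>?Q\<^esub> (b \<odot>\<^bsub>?Q\<^esub> X)"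
      unfolding x by (simp only: sm x a b M.R.m_closed M.smult_closed M.smult_assoc1)
  next
    fix a X Y assume a: "a \<in> carrier K" and "X \<in> carrier ?Q" "Y \<in> carrier ?Q"
    then obtain x y where x: "x \<in> carrier M" "X = N +>\<^bsub>M\<^esub> x" "y \<in> carrier M" "Y = N +>\<^bsub>M\<^esub> y" using rep by blast
    show "a \<odot>\<^bsub>?Q\<^esub> (X \<oplus>\<^bsub>?Q\<^esub> Y) = a \<odot>\<^bsub>?Q\<^esub> X \<oplus>\<^bsub>?Q\<^esub> a \<odot>\<^bsub>?Q\<^esub> Y"
      unfolding x by (simp only: sm x a add M.smult_closed M.M.a_closed M.smult_r_distr)
  next
    fix X assume "X \<in> carrier ?Q"
    then obtain x where x: "x \<in> carrier M" "X = N +>\<^bsub>M\<^esub> x" using rep by blast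
    show "\<one>\<^bsub>K\<^esub> \<odot>\<^bsub>?Q\<^esub> X = X" unfolding x by (simp only: sm x M.R.one_closed M.smult_one)
  qed
  show "(\<lambda>x. N +>\<^bsub>M\<^esub> x) \<in> module_hom K M ?Q"
    unfolding module_hom_def using sm add mem by (auto simp del: quotient_module_simps)
qed

lemma submodule_Inter:
  assumes M: "module K M" and R: "R \<subseteq> carrier M"
  shows "submodule (\<Inter>{N. submodule N K M \<and> R \<subseteq> N}) K M"
proof -
  interpret module K M by fact
  show ?thesis
  proof (rule submoduleI)
    show "\<Inter>{N. submodule N K M \<and> R \<subseteq> N} \<subseteq> carrier M"
      using carrier_is_submodule R by auto
    show "\<zero>\<^bsub>M\<^esub> \<in> \<Inter>{N. submodule N K M \<and> R \<subseteq> N}"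
      using subgroup.one_closed[OF submodule.axioms(1)] by auto
  qed (blast dest: submoduleE(3) submoduleE(5) submoduleE(4))+
qed

lemma module_hom_D:
  assumes "f \<in> module_hom K A B"
  shows "x \<in> carrier A \<Longrightarrow> f x \<in> carrier B"
    and "x \<in> carrier A \<Longrightarrow> y \<in> carrier A \<Longrightarrow> f (x \<oplus>\<^bsub>A\<^esub> y) = f x \<oplus>\<^bsub>B\<^esub> f y"
    and "r \<in> carrier K \<Longrightarrow> x \<in> carrier A \<Longrightarrow> f (r \<odot>\<^bsub>A\<^esub> x) = r \<odot>\<^bsub>B\<^esub> f x"
  using assms by (auto simp: module_hom_def)

lemma module_hom_more:
  assumes f: "f \<in> module_hom K A B" and A: "module K A" and B: "module K B"
  shows "f \<zero>\<^bsub>A\<^esub> = \<zero>\<^bsub>B\<^esub>" 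
    and "x \<in> carrier A \<Longrightarrow> f (\<ominus>\<^bsub>A\<^esub> x) = \<ominus>\<^bsub>B\<^esub> f x"
    and "x \<in> carrier A \<Longrightarrow> y \<in> carrier A \<Longrightarrow> f (x \<ominus>\<^bsub>A\<^esub> y) = f x \<ominus>\<^bsub>B\<^esub> f y"
proof -
  interpret A: module K A by fact
  interpret B: module K B by fact
  note D = module_hom_D[OF f]
  show z: "f \<zero>\<^bsub>A\<^esub> = \<zero>\<^bsub>B\<^esub>"
    using D(3)[of "\<zero>\<^bsub>K\<^esub>" "\<zero>\<^bsub>A\<^esub>"] D(1)[of "\<zero>\<^bsub>A\<^esub>"] by simp
  show n: "f (\<ominus>\<^bsub>A\<^esub> x) = \<ominus>\<^bsub>B\<^esub> f x" if x: "x \<in> carrier A" for x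
    using D(3)[of "\<ominus>\<^bsub>K\<^esub> \<one>\<^bsub>K\<^esub>" x] D(1)[OF x] x
    by (simp add: A.smult_l_minus B.smult_l_minus)
  show "x \<in> carrier A \<Longrightarrow> y \<in> carrier A \<Longrightarrow> f (x \<ominus>\<^bsub>A\<^esub> y) = f x \<ominus>\<^bsub>B\<^esub> f y"
    unfolding a_minus_def by (simp add: D n)
qed

lemma tensor_universal_aux:
  assumes A: "module K A" and B: "module K B"
  shows "module K (tensor K A B)"
    and "bilinear_map K A B (tensor K A B) (pure_tensor K A B)"
    and "\<And>N f. module K N \<Longrightarrow> bilinear_map K A B N f \<Longrightarrow>
          tensor_lift K N f \<in> module_hom K (tensor K A B) N \<and>
          (\<forall>a\<in>carrier A. \<forall>b\<in>carrier B. tensor_lift K N f (pure_tensor K A B a b) = f a b)"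
proof -
  interpret A: module K A by fact
  interpret B: module K B by fact
  let ?X = "carrier A \<times> carrier B"
  let ?F = "tensor_free K A B" and ?N = "tensor_null K A B" and ?R = "bilinear_relations K A B"
  have Fm: "module K ?F" unfolding tensor_free_def by (rule A.R.free_module_module)
  interpret F: module K ?F by (rule Fm)
  have e: "free_gen K (a,b) \<in> carrier ?F" if "a \<in> carrier A" "b \<in> carrier B" for a b
    using that A.R.free_gen_closed[of "(a,b)" ?X] by (auto simp: tensor_free_def)
  have R: "?R \<subseteq> carrier ?F"
    by (auto simp: bilinear_relations_def Let_def e)
  have N: "submodule ?N K ?F" unfolding tensor_null_def by (rule submodule_Inter[OF Fm R])
  have RN: "?R \<subseteq> ?N" unfolding tensor_null_def by blast
  show T: "module K (tensor K A B)" unfolding tensor_def by (rule quotient_module_facts[OF Fm N])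
  have q: "(\<lambda>x. ?N +>\<^bsub>?F\<^esub> x) \<in> module_hom K ?F (tensor K A B)"
    unfolding tensor_def by (rule quotient_module_facts[OF Fm N])
  interpret S: abelian_subgroup ?N ?F
    by (rule abelian_subgroupI3) (auto intro: additive_subgroup.intro submodule.axioms(1)[OF N] F.M.abelian_group_axioms)
  have eq: "?N +>\<^bsub>?F\<^esub> x = ?N +>\<^bsub>?F\<^esub> y" if "x \<in> carrier ?F" "y \<in> carrier ?F" "x \<ominus>\<^bsub>?F\<^esub> y \<in> ?R" for x y
  proof -
    have "x = (x \<ominus>\<^bsub>?F\<^esub> y) \<oplus>\<^bsub>?F\<^esub> y" using that by (simp add: a_minus_def F.M.a_assoc F.M.l_neg)
    then have "x \<in> ?N +>\<^bsub>?F\<^esub> y" using that RN by (auto simp: a_r_coset_defs)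
    then show ?thesis using S.a_repr_independence'[of x y] that by simp
  qed
  note q' = module_hom_D[OF q]
  have eq1: "?N +>\<^bsub>?F\<^esub> free_gen K (a \<oplus>\<^bsub>A\<^esub> a', b) = ?N +>\<^bsub>?F\<^esub> (free_gen K (a, b) \<oplus>\<^bsub>?F\<^esub> free_gen K (a', b))" if "a \<in> carrier A" "a' \<in> carrier A" "b \<in> carrier B" for a a' b
  proof (rule eq)
    show "free_gen K (a \<oplus>\<^bsub>A\<^esub> a', b) \<ominus>\<^bsub>?F\<^esub> (free_gen K (a, b) \<oplus>\<^bsub>?F\<^esub> free_gen K (a', b)) \<in> ?R"
      unfolding bilinear_relations_def Let_def using that by blast
  qed (use that in \<open>auto intro!: e F.M.a_closed F.smult_closed\<close>)
  have eq2: "?N +>\<^bsub>?F\<^esub> free_gen K (a, b \<oplus>\<^bsub>B\<^esub> b') = ?N +>\<^bsub>?F\<^esub> (free_gen K (a, b) \<oplus>\<^bsub>?F\<^esub> free_gen K (a, b'))" if "a \<in> carrier A" "b \<in> carrier B" "b' \<in> carrier B" for a b b'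
  proof (rule eq)
    show "free_gen K (a, b \<oplus>\<^bsub>B\<^esub> b') \<ominus>\<^bsub>?F\<^esub> (free_gen K (a, b) \<oplus>\<^bsub>?F\<^esub> free_gen K (a, b')) \<in> ?R"
      unfolding bilinear_relations_def Let_def using that by blast
  qed (use that in \<open>auto intro!: e F.M.a_closed F.smult_closed\<close>)
  have eq3: "?N +>\<^bsub>?F\<^esub> free_gen K (r \<odot>\<^bsub>A\<^esub> a, b) = ?N +>\<^bsub>?F\<^esub> (r \<odot>\<^bsub>?F\<^esub> free_gen K (a, b))" if "r \<in> carrier K" "a \<in> carrier A" "b \<in> carrier B" for r a b
  proof (rule eq)
    show "free_gen K (r \<odot>\<^bsub>A\<^esub> a, b) \<ominus>\<^bsub>?F\<^esub> (r \<odot>\<^bsub>?F\<^esub> free_gen K (a, b)) \<in> ?R"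
      unfolding bilinear_relations_def Let_def using that by blast
  qed (use that in \<open>auto intro!: e F.M.a_closed F.smult_closed\<close>)
  have eq4: "?N +>\<^bsub>?F\<^esub> free_gen K (a, r \<odot>\<^bsub>B\<^esub> b) = ?N +>\<^bsub>?F\<^esub> (r \<odot>\<^bsub>?F\<^esub> free_gen K (a, b))" if "r \<in> carrier K" "a \<in> carrier A" "b \<in> carrier B" for r a b
  proof (rule eq)
    show "free_gen K (a, r \<odot>\<^bsub>B\<^esub> b) \<ominus>\<^bsub>?F\<^esub> (r \<odot>\<^bsub>?F\<^esub> free_gen K (a, b)) \<in> ?R"
      unfolding bilinear_relations_def Let_def using that by blast
  qed (use that in \<open>auto intro!: e F.M.a_closed F.smult_closed\<close>)
  show "bilinear_map K A B (tensor K A B) (pure_tensor K A B)"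
    unfolding bilinear_map_def module_hom_def pure_tensor_def
  proof (intro conjI ballI CollectI funcsetI, goal_cases)
    case (1 a b) then show ?case by (intro q'(1) e)
  next
    case (2 a b b') then show ?case
      by (subst q'(2)[symmetric]) (auto intro!: e simp: eq2)
  next
    case (3 a r b) then show ?case
      by (subst q'(3)[symmetric]) (auto intro!: e simp: eq4)
  next
    case (4 b a) then show ?case by (intro q'(1) e)
  next
    case (5 b a a') then show ?case
      by (subst q'(2)[symmetric]) (auto intro!: e simp: eq1)
  next
    case (6 b r a) then show ?case
      by (subst q'(3)[symmetric]) (auto intro!: e simp: eq3)
  qed
  fix N f assume Nm: "module K (N :: ('a,'g,'h) module_scheme)" and f: "bilinear_map K A B N f"
  interpret Nm: module K N by fact
  let ?g = "\<lambda>(a,b). f a b"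
  have g: "?g \<in> ?X \<rightarrow> carrier N" using f by (auto simp: bilinear_map_def module_hom_def Pi_iff)
  have h: "free_lift K N ?g \<in> module_hom K ?F N"
    unfolding tensor_free_def by (rule free_lift_hom[OF Nm g])
  note hD = module_hom_D[OF h] and hM = module_hom_more[OF h Fm Nm]
  have hg: "free_lift K N ?g (free_gen K (a,b)) = f a b" if "a \<in> carrier A" "b \<in> carrier B" for a b
    using free_lift_gen[OF Nm g, of "(a,b)"] that by simp
  have fc: "f a b \<in> carrier N" if "a \<in> carrier A" "b \<in> carrier B" for a b using funcset_mem[OF g, of "(a,b)"] that by simp
  have ker: "submodule {u \<in> carrier ?F. free_lift K N ?g u = \<zero>\<^bsub>N\<^esub>} K ?F"
    by (rule F.submoduleI) (auto simp: hD hM)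
  have fb: "\<And>a a' b. a \<in> carrier A \<Longrightarrow> a' \<in> carrier A \<Longrightarrow> b \<in> carrier B \<Longrightarrow> f (a \<oplus>\<^bsub>A\<^esub> a') b = f a b \<oplus>\<^bsub>N\<^esub> f a' b"
      "\<And>a b b'. a \<in> carrier A \<Longrightarrow> b \<in> carrier B \<Longrightarrow> b' \<in> carrier B \<Longrightarrow> f a (b \<oplus>\<^bsub>B\<^esub> b') = f a b \<oplus>\<^bsub>N\<^esub> f a b'"
      "\<And>a b r. a \<in> carrier A \<Longrightarrow> b \<in> carrier B \<Longrightarrow> r \<in> carrier K \<Longrightarrow> f (r \<odot>\<^bsub>A\<^esub> a) b = r \<odot>\<^bsub>N\<^esub> f a b"
      "\<And>a b r. a \<in> carrier A \<Longrightarrow> b \<in> carrier B \<Longrightarrow> r \<in> carrier K \<Longrightarrow> f a (r \<odot>\<^bsub>B\<^esub> b) = r \<odot>\<^bsub>N\<^esub> f a b"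
    using f unfolding bilinear_map_def module_hom_def by auto
  have "?R \<subseteq> {u \<in> carrier ?F. free_lift K N ?g u = \<zero>\<^bsub>N\<^esub>}"
    using R by (auto simp: bilinear_relations_def Let_def hM hD hg e fb fc a_minus_def Nm.M.r_neg)
  then have null: "?N \<subseteq> {u \<in> carrier ?F. free_lift K N ?g u = \<zero>\<^bsub>N\<^esub>}"
    unfolding tensor_null_def using ker by blast
  have lift: "tensor_lift K N f (?N +>\<^bsub>?F\<^esub> u) = free_lift K N ?g u" if u: "u \<in> carrier ?F" for u
  proof -
    have "u \<in> ?N +>\<^bsub>?F\<^esub> u" using u by (rule S.a_rcos_self)
    then have "(SOME v. v \<in> ?N +>\<^bsub>?F\<^esub> u) \<in> ?N +>\<^bsub>?F\<^esub> u" by (rule someI[where P="\<lambda>v. v \<in> ?N +>\<^bsub>?F\<^esub> u"])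
    then obtain n where n: "n \<in> ?N" "(SOME v. v \<in> ?N +>\<^bsub>?F\<^esub> u) = n \<oplus>\<^bsub>?F\<^esub> u"
      by (auto simp: a_r_coset_defs)
    have "n \<in> carrier ?F" "free_lift K N ?g n = \<zero>\<^bsub>N\<^esub>" using n null by auto
    then show ?thesis unfolding tensor_lift_def n(2) using u by (simp add: hD)
  qed
  have rep: "\<exists>x\<in>carrier ?F. X = ?N +>\<^bsub>?F\<^esub> x" if "X \<in> carrier (tensor K A B)" for X
    using that by (auto simp: tensor_def A_RCOSETS_def RCOSETS_def a_r_coset_def)
  have "tensor_lift K N f \<in> module_hom K (tensor K A B) N"
    unfolding module_hom_def
    by (auto dest!: rep simp: lift hD q'(2,3)[symmetric])
  moreover have "tensor_lift K N f (pure_tensor K A B a b) = f a b"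
    if "a \<in> carrier A" "b \<in> carrier B" for a b
    unfolding pure_tensor_def using that by (simp add: lift e hg)
  ultimately show "tensor_lift K N f \<in> module_hom K (tensor K A B) N \<and>
      (\<forall>a\<in>carrier A. \<forall>b\<in>carrier B. tensor_lift K N f (pure_tensor K A B a b) = f a b)"
    by blast
qed

lemma tensor_module: "module K A \<Longrightarrow> module K B \<Longrightarrow> module K (tensor K A B)"
  by (rule tensor_universal_aux)

lemma pure_tensor_bilinear:
  "module K A \<Longrightarrow> module K B \<Longrightarrow> bilinear_map K A B (tensor K A B) (pure_tensor K A B)"
  by (rule tensor_universal_aux)

lemma tensor_lift_hom:
  "module K A \<Longrightarrow> module K B \<Longrightarrow> module K N \<Longrightarrow> bilinear_map K A B N f
    \<Longrightarrow> tensor_lift K N f \<in> module_hom K (tensor K A B) N"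
  using tensor_universal_aux(3) by blast

lemma tensor_lift_pure:
  "module K A \<Longrightarrow> module K B \<Longrightarrow> module K N \<Longrightarrow> bilinear_map K A B N f
    \<Longrightarrow> a \<in> carrier A \<Longrightarrow> b \<in> carrier B
    \<Longrightarrow> tensor_lift K N f (pure_tensor K A B a b) = f a b"
  using tensor_universal_aux(3) by blast


section \<open>Coalgebras, comodules, Rota-Baxter paired comodules\<close>

locale coalgebra = K?: field K + C?: module K C for K (structure) and C (structure) +
  fixes \<Delta> and \<epsilon>
  assumes comult_linear: "\<Delta> \<in> module_hom K C (tensor K C C)"
    and counit_linear: "\<epsilon> \<in> linear_dual K C"
    and coassoc: "c \<in> carrier C \<Longrightarrow>
      tensor_assoc K C C C (tensor_map K (tensor K C C) C \<Delta> (\<lambda>x. x) (\<Delta> c))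
        = tensor_map K C (tensor K C C) (\<lambda>x. x) \<Delta> (\<Delta> c)"
    and counit_left: "c \<in> carrier C \<Longrightarrow> tensor_lift K C (\<lambda>a b. \<epsilon> a \<odot>\<^bsub>C\<^esub> b) (\<Delta> c) = c"
    and counit_right: "c \<in> carrier C \<Longrightarrow> tensor_lift K C (\<lambda>a b. \<epsilon> b \<odot>\<^bsub>C\<^esub> a) (\<Delta> c) = c"

definition convolution ::
  "('k, 'r) ring_scheme \<Rightarrow> ('c \<Rightarrow> ('c \<times> 'c \<Rightarrow> 'k) set) \<Rightarrow> ('c \<Rightarrow> 'k) \<Rightarrow> ('c \<Rightarrow> 'k) \<Rightarrow> 'c \<Rightarrow> 'k"
  where "convolution K \<Delta> \<phi> \<psi> c =
    tensor_lift K (scalar_module K) (\<lambda>a b. \<phi> a \<otimes>\<^bsub>K\<^esub> \<psi> b) (\<Delta> c)"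

locale left_comodule = coalgebra K C \<Delta> \<epsilon> + M?: module K M
  for K (structure) and C (structure) and \<Delta> and \<epsilon> and M (structure) +
  fixes \<rho>
  assumes coaction_linear: "\<rho> \<in> module_hom K M (tensor K C M)"
    and coaction_coassoc: "m \<in> carrier M \<Longrightarrow>
      tensor_assoc K C C M (tensor_map K (tensor K C C) M \<Delta> (\<lambda>x. x) (\<rho> m))
        = tensor_map K C (tensor K C M) (\<lambda>x. x) \<rho> (\<rho> m)"
    and coaction_counit: "m \<in> carrier M \<Longrightarrow> tensor_lift K M (\<lambda>c n. \<epsilon> c \<odot>\<^bsub>M\<^esub> n) (\<rho> m) = m"

locale rota_baxter_paired_comodule = left_comodule K C \<Delta> \<epsilon> M \<rho>
  for K (structure) and C (structure) and \<Delta> and \<epsilon> and M (structure) and \<rho> +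
  fixes P and T and w
  assumes weight_closed: "w \<in> carrier K"
    and P_linear: "P \<in> module_hom K C C"
    and T_linear: "T \<in> module_hom K M M"
    and rota_baxter: "m \<in> carrier M \<Longrightarrow>
      tensor_map K C M P T (\<rho> m) =
        tensor_map K C M P (\<lambda>x. x) (\<rho> (T m))
        \<oplus>\<^bsub>tensor K C M\<^esub> tensor_map K C M (\<lambda>x. x) T (\<rho> (T m))
        \<oplus>\<^bsub>tensor K C M\<^esub> w \<odot>\<^bsub>tensor K C M\<^esub> \<rho> (T m)"

end

theory Submission
  imports Defs
begin

text \<open>
  Applying \<open>\<chi> \<otimes> id \<otimes> id\<close> to the coassociativity law of \<open>\<rho>\<close> gives \<open>(P \<otimes> id)\<rho> = \<rho>T\<close>.
  Applying \<open>\<chi> \<otimes> id\<close> to this and using \<open>\<chi> \<circ> P = \<chi> * \<chi> = \<chi>\<close> gives \<open>TT = T\<close>.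
  Hence \<open>(P \<otimes> id)\<rho>T = \<rho>TT = \<rho>T\<close> cancels against \<open>-\<rho>T\<close>, and what remains is
  \<open>(P \<otimes> T)\<rho> = (id \<otimes> T)(P \<otimes> id)\<rho> = (id \<otimes> T)\<rho>T\<close>.
\<close>

section \<open>Closure properties of linear maps\<close>

lemma module_homI:
  assumes "\<And>x. x \<in> carrier A \<Longrightarrow> f x \<in> carrier B"
    and "\<And>x y. x \<in> carrier A \<Longrightarrow> y \<in> carrier A \<Longrightarrow> f (x \<oplus>\<^bsub>A\<^esub> y) = f x \<oplus>\<^bsub>B\<^esub> f y"
    and "\<And>r x. r \<in> carrier K \<Longrightarrow> x \<in> carrier A \<Longrightarrow> f (r \<odot>\<^bsub>A\<^esub> x) = r \<odot>\<^bsub>B\<^esub> f x"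
  shows "f \<in> module_hom K A B"
  using assms by (auto simp: module_hom_def)

lemma module_hom_id: "(\<lambda>x. x) \<in> module_hom K A A"
  by (auto simp: module_hom_def)

lemma module_hom_comp:
  "f \<in> module_hom K A B \<Longrightarrow> g \<in> module_hom K B D \<Longrightarrow> (\<lambda>x. g (f x)) \<in> module_hom K A D"
  by (rule module_homI) (auto simp: module_hom_D)

text \<open>Meant for maps such as \<open>P\<close> and \<open>T\<close>, which are prescribed by a
  formula on the carrier only. Sums and multiples stay in the carrier of the module
  \<open>A\<close>, so linearity carries over from the formula.\<close>

lemma module_hom_cong:
  assumes "f \<in> module_hom K A B" "module K A" "\<And>x. x \<in> carrier A \<Longrightarrow> g x = f x"
  shows "g \<in> module_hom K A B"
proof -
  interpret module K A by fact
  show ?thesis by (rule module_homI) (use assms in \<open>auto simp: module_hom_D\<close>)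
qed

lemma module_hom_add:
  assumes "f \<in> module_hom K A B" "g \<in> module_hom K A B" "module K B"
  shows "(\<lambda>x. f x \<oplus>\<^bsub>B\<^esub> g x) \<in> module_hom K A B"
proof -
  interpret B: module K B by fact
  show ?thesis
    by (rule module_homI)
      (use assms(1,2) in \<open>simp_all add: module_hom_D B.smult_r_distr B.M.a_ac\<close>)
qed

lemma module_hom_smult:
  assumes "f \<in> module_hom K A B" "r \<in> carrier K" "module K B"
  shows "(\<lambda>x. r \<odot>\<^bsub>B\<^esub> f x) \<in> module_hom K A B"
proof -
  interpret B: module K B by fact
  show ?thesis
    by (rule module_homI)
      (use assms(1,2) in \<open>simp_all add: module_hom_D B.smult_r_distr B.R.m_comm flip: B.smult_assoc1\<close>)
qed

section \<open>Linear maps are determined on generators and on pure tensors\<close>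

text \<open>Every element has finite support, so it can be reduced to zero by peeling off one
  generator at a time. This is the uniqueness half of the universal property of the free
  module.\<close>

lemma free_module_hom_eqI:
  assumes N: "module K N"
    and f: "f \<in> module_hom K (free_module K X) N" and g: "g \<in> module_hom K (free_module K X) N"
    and gen: "\<And>x. x \<in> X \<Longrightarrow> f (free_gen K x) = g (free_gen K x)"
    and u: "u \<in> carrier (free_module K X)"
  shows "f u = g u"
proof -
  interpret N: module K N by fact
  let ?F = "free_module K X"
  have F: "module K ?F" by (rule N.R.free_module_module)
  interpret F: module K ?F by (rule F)
  \<comment> \<open>\<open>S\<close> is any finite set containing the support, not necessarily
    inside \<open>X\<close>. The vector is quantified inside because the induction step passes to a
    different one.\<close>
  have "\<forall>u\<in>carrier ?F. {x. u x \<noteq> \<zero>\<^bsub>K\<^esub>} \<subseteq> S \<longrightarrow> f u = g u" if "finite S" for S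
    using that
  proof induction
    case empty
    have "f u = g u" if "\<forall>x. u x = \<zero>\<^bsub>K\<^esub>" for u
    proof -
      have "u = \<zero>\<^bsub>?F\<^esub>" using that by auto
      then show ?thesis using module_hom_more(1)[OF f F N] module_hom_more(1)[OF g F N] by simp
    qed
    then show ?case by auto
  next
    case (insert a S)
    show ?case
    proof (intro ballI impI)
      fix u assume u: "u \<in> carrier ?F" and su: "{x. u x \<noteq> \<zero>\<^bsub>K\<^esub>} \<subseteq> insert a S"
      show "f u = g u"
      proof (cases "a \<in> X")
        case False
        then have "u a = \<zero>\<^bsub>K\<^esub>" using u by (auto simp: free_module_carrier)
        then have "{x. u x \<noteq> \<zero>\<^bsub>K\<^esub>} \<subseteq> S" using su by auto
        then show ?thesis using insert.IH u by blast
      next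
        case True
        \<comment> \<open>Erasing the coefficient at \<open>a\<close> leaves a vector supported in
          \<open>S\<close>, to which the induction hypothesis applies; \<open>u\<close> is
          \<open>v\<close> plus \<open>u a\<close> times the generator at \<open>a\<close>.\<close>
        define v where "v = u(a := \<zero>\<^bsub>K\<^esub>)"
        have "finite {x. u x \<noteq> \<zero>\<^bsub>K\<^esub>}" using u by (simp add: free_module_carrier)
        then have "finite {x. v x \<noteq> \<zero>\<^bsub>K\<^esub>}"
          by (rule rev_finite_subset) (auto simp: v_def)
        then have v: "v \<in> carrier ?F"
          using u by (simp add: free_module_carrier v_def)
        have ua: "u a \<in> carrier K" by (rule N.R.free_val[OF u])
        have e: "free_gen K a \<in> carrier ?F" by (rule N.R.free_gen_closed[OF True])
        have uv: "u = u a \<odot>\<^bsub>?F\<^esub> free_gen K a \<oplus>\<^bsub>?F\<^esub> v"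
          using N.R.free_val[OF u] by (auto simp: v_def free_gen_def fun_eq_iff)
        have "{x. v x \<noteq> \<zero>\<^bsub>K\<^esub>} \<subseteq> S" using su by (auto simp: v_def)
        then have "f v = g v" using insert.IH v by blast
        moreover have split: "h u = u a \<odot>\<^bsub>N\<^esub> h (free_gen K a) \<oplus>\<^bsub>N\<^esub> h v"
          if h: "h \<in> module_hom K ?F N" for h
          using arg_cong[OF uv, of h] module_hom_D(2)[OF h F.smult_closed[OF ua e] v]
            module_hom_D(3)[OF h ua e] by simp
        ultimately show ?thesis by (simp only: split[OF f] split[OF g] gen[OF True])
      qed
    qed
  qed
  then show ?thesis using u by (auto simp: free_module_carrier)
qed

text \<open>Composing both maps with the projection from the free module reduces the claim to
  generators, whose images are the pure tensors. This justifies the Sweedler-style computations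
  below: once both sides are linear, an identity is checked on pure tensors.\<close>

lemma tensor_hom_eqI:
  assumes A: "module K A" and B: "module K B" and N: "module K N"
    and f: "f \<in> module_hom K (tensor K A B) N" and g: "g \<in> module_hom K (tensor K A B) N"
    and pure: "\<And>a b. a \<in> carrier A \<Longrightarrow> b \<in> carrier B \<Longrightarrow>
      f (pure_tensor K A B a b) = g (pure_tensor K A B a b)"
    and X: "X \<in> carrier (tensor K A B)"
  shows "f X = g X"
proof -
  interpret A: module K A by fact
  interpret B: module K B by fact
  let ?F = "tensor_free K A B" and ?N = "tensor_null K A B"
  have Fm: "module K ?F" unfolding tensor_free_def by (rule A.R.free_module_module)
  interpret F: module K ?F by (rule Fm)
  have e: "free_gen K (a, b) \<in> carrier ?F" if "a \<in> carrier A" "b \<in> carrier B" for a b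
    using that A.R.free_gen_closed[of "(a, b)" "carrier A \<times> carrier B"] by (auto simp: tensor_free_def)
  have "bilinear_relations K A B \<subseteq> carrier ?F"
    by (auto simp: bilinear_relations_def Let_def e)
  then have "submodule ?N K ?F" unfolding tensor_null_def by (rule submodule_Inter[OF Fm])
  then have q: "(\<lambda>x. ?N +>\<^bsub>?F\<^esub> x) \<in> module_hom K ?F (tensor K A B)"
    unfolding tensor_def by (rule quotient_module_facts[OF Fm])
  obtain u where u: "u \<in> carrier ?F" "X = ?N +>\<^bsub>?F\<^esub> u"
    using X by (auto simp: tensor_def A_RCOSETS_def RCOSETS_def a_r_coset_def)
  have "f (?N +>\<^bsub>?F\<^esub> u) = g (?N +>\<^bsub>?F\<^esub> u)"
    by (rule free_module_hom_eqI[OF N module_hom_comp[OF q f, unfolded tensor_free_def]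
          module_hom_comp[OF q g, unfolded tensor_free_def], folded tensor_free_def, OF _ u(1)])
      (use pure in \<open>auto simp: pure_tensor_def\<close>)
  then show ?thesis by (simp add: u(2))
qed

section \<open>Tensor products of maps and the associator\<close>

lemma bilinear_mapI:
  assumes "\<And>a. a \<in> carrier A \<Longrightarrow> f a \<in> module_hom K B N"
    and "\<And>b. b \<in> carrier B \<Longrightarrow> (\<lambda>a. f a b) \<in> module_hom K A N"
  shows "bilinear_map K A B N f"
  using assms by (simp add: bilinear_map_def)

lemma pure_tensor_hom:
  assumes "module K A" "module K B"
  shows "a \<in> carrier A \<Longrightarrow> pure_tensor K A B a \<in> module_hom K B (tensor K A B)"
    and "b \<in> carrier B \<Longrightarrow> (\<lambda>a. pure_tensor K A B a b) \<in> module_hom K A (tensor K A B)"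
  using pure_tensor_bilinear[OF assms] by (auto simp: bilinear_map_def)

lemma pure_tensor_closed:
  "module K A \<Longrightarrow> module K B \<Longrightarrow> a \<in> carrier A \<Longrightarrow> b \<in> carrier B \<Longrightarrow>
    pure_tensor K A B a b \<in> carrier (tensor K A B)"
  by (rule module_hom_D(1)[OF pure_tensor_hom(1)])

lemma tensor_map_hom_pure:
  assumes A: "module K A" and B: "module K B" and A': "module K A'" and B': "module K B'"
    and f: "f \<in> module_hom K A A'" and g: "g \<in> module_hom K B B'"
  shows tensor_map_hom: "tensor_map K A' B' f g \<in> module_hom K (tensor K A B) (tensor K A' B')"
    and tensor_map_pure: "a \<in> carrier A \<Longrightarrow> b \<in> carrier B \<Longrightarrow>
      tensor_map K A' B' f g (pure_tensor K A B a b) = pure_tensor K A' B' (f a) (g b)"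
proof -
  have T: "module K (tensor K A' B')" by (rule tensor_module[OF A' B'])
  have bil: "bilinear_map K A B (tensor K A' B') (\<lambda>a b. pure_tensor K A' B' (f a) (g b))"
    by (rule bilinear_mapI)
      (intro module_hom_comp[OF g] module_hom_comp[OF f, where g="\<lambda>a. pure_tensor K A' B' a _"]
         pure_tensor_hom[OF A' B'] module_hom_D(1)[OF f] module_hom_D(1)[OF g]; assumption)+
  show "tensor_map K A' B' f g \<in> module_hom K (tensor K A B) (tensor K A' B')"
    unfolding tensor_map_def by (rule tensor_lift_hom[OF A B T bil])
  show "a \<in> carrier A \<Longrightarrow> b \<in> carrier B \<Longrightarrow>
      tensor_map K A' B' f g (pure_tensor K A B a b) = pure_tensor K A' B' (f a) (g b)"
    unfolding tensor_map_def by (rule tensor_lift_pure[OF A B T bil])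
qed

text \<open>The associator is a lift inside a lift, so the inner lift must depend linearly on
  \<open>d\<close> at every tensor \<open>x\<close>, pure or not. For fixed \<open>d\<close> it is
  linear in \<open>x\<close>, so \<open>tensor_hom_eqI\<close> reduces this to pure
  \<open>x\<close>.\<close>

lemma tensor_assoc_hom_pure:
  assumes A: "module K A" and B: "module K B" and D: "module K D"
  shows tensor_assoc_hom: "tensor_assoc K A B D \<in>
      module_hom K (tensor K (tensor K A B) D) (tensor K A (tensor K B D))"
    and tensor_assoc_pure: "a \<in> carrier A \<Longrightarrow> b \<in> carrier B \<Longrightarrow> d \<in> carrier D \<Longrightarrow>
      tensor_assoc K A B D (pure_tensor K (tensor K A B) D (pure_tensor K A B a b) d)
        = pure_tensor K A (tensor K B D) a (pure_tensor K B D b d)"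
proof -
  let ?BD = "tensor K B D"
  let ?Q = "tensor K A ?BD"
  let ?f = "\<lambda>d a b. pure_tensor K A ?BD a (pure_tensor K B D b d)"
  have AB: "module K (tensor K A B)" by (rule tensor_module[OF A B])
  have BD: "module K ?BD" by (rule tensor_module[OF B D])
  have Q: "module K ?Q" by (rule tensor_module[OF A BD])
  note pc = pure_tensor_closed[OF B D]
  have inner: "bilinear_map K A B ?Q (?f d)" if d: "d \<in> carrier D" for d
    by (rule bilinear_mapI)
      (intro module_hom_comp[OF pure_tensor_hom(2)[OF B D d]] pure_tensor_hom[OF A BD] pc d; assumption)+
  note L = tensor_lift_hom[OF A B Q inner] and Lp = tensor_lift_pure[OF A B Q inner]
  \<comment> \<open>Linearity in the third slot for fixed \<open>a\<close> and \<open>b\<close>: the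
    form the claim about the inner lift takes on a pure tensor.\<close>
  have f: "(\<lambda>d. ?f d a b) \<in> module_hom K D ?Q" if "a \<in> carrier A" "b \<in> carrier B" for a b
    by (rule module_hom_comp[OF pure_tensor_hom(1)[OF B D that(2)] pure_tensor_hom(1)[OF A BD that(1)]])
  interpret D: module K D by fact
  have bil: "bilinear_map K (tensor K A B) D ?Q (\<lambda>x d. tensor_lift K ?Q (?f d) x)"
  proof (rule bilinear_mapI)
    fix x assume x: "x \<in> carrier (tensor K A B)"
    show "(\<lambda>d. tensor_lift K ?Q (?f d) x) \<in> module_hom K D ?Q"
    proof (rule module_homI)
      fix d assume d: "d \<in> carrier D"
      show "tensor_lift K ?Q (?f d) x \<in> carrier ?Q"
        by (rule module_hom_D(1)[OF L[OF d] x])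
      fix d' assume d': "d' \<in> carrier D"
      show "tensor_lift K ?Q (?f (d \<oplus>\<^bsub>D\<^esub> d')) x
          = tensor_lift K ?Q (?f d) x \<oplus>\<^bsub>?Q\<^esub> tensor_lift K ?Q (?f d') x"
        by (rule tensor_hom_eqI[OF A B Q L module_hom_add[OF L L Q] _ x])
          (simp_all add: d d' Lp module_hom_D(2)[OF f])
    next
      fix r d assume r: "r \<in> carrier K" and d: "d \<in> carrier D"
      show "tensor_lift K ?Q (?f (r \<odot>\<^bsub>D\<^esub> d)) x = r \<odot>\<^bsub>?Q\<^esub> tensor_lift K ?Q (?f d) x"
        by (rule tensor_hom_eqI[OF A B Q L module_hom_smult[OF L r Q] _ x])
          (simp_all add: d r Lp module_hom_D(3)[OF f])
    qed
  qed (rule L)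
  show "tensor_assoc K A B D \<in> module_hom K (tensor K (tensor K A B) D) ?Q"
    unfolding tensor_assoc_def by (rule tensor_lift_hom[OF AB D Q bil])
  show "tensor_assoc K A B D (pure_tensor K (tensor K A B) D (pure_tensor K A B a b) d) = ?f d a b"
    if "a \<in> carrier A" "b \<in> carrier B" "d \<in> carrier D" for a b d
    unfolding tensor_assoc_def
    by (simp add: tensor_lift_pure[OF AB D Q bil] pure_tensor_closed[OF A B] Lp that)
qed

section \<open>The ground field as a module, and contraction with a functional\<close>

lemma scalar_module_simps [simp]:
  "carrier (scalar_module K) = carrier K"
  "\<zero>\<^bsub>scalar_module K\<^esub> = \<zero>\<^bsub>K\<^esub>"
  "x \<oplus>\<^bsub>scalar_module K\<^esub> y = x \<oplus>\<^bsub>K\<^esub> y"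
  "x \<odot>\<^bsub>scalar_module K\<^esub> y = x \<otimes>\<^bsub>K\<^esub> y"
  by (simp_all add: scalar_module_def)

lemma (in cring) scalar_module_module: "module R (scalar_module R)"
proof (rule moduleI)
  show "abelian_group (scalar_module R)"
    by (rule abelian_groupI) (auto simp: a_ac l_distr r_distr intro: add.l_inv_ex)
qed (auto simp: is_cring m_assoc l_distr r_distr)

text \<open>\<open>contract K N \<chi>\<close> is \<open>\<chi> \<otimes> id\<close> followed by the identification of \<open>K \<otimes> N\<close> with \<open>N\<close>.\<close>

abbreviation (input) contract ::
  "('k, 'r) ring_scheme \<Rightarrow> ('k, 'n, 's) module_scheme \<Rightarrow> ('a \<Rightarrow> 'k) \<Rightarrow> ('a \<times> 'n \<Rightarrow> 'k) set \<Rightarrow> 'n"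
  where "contract K N \<chi> \<equiv> tensor_lift K N (\<lambda>a n. \<chi> a \<odot>\<^bsub>N\<^esub> n)"

lemma contract_hom_pure:
  assumes A: "module K A" and N: "module K N" and \<chi>: "\<chi> \<in> linear_dual K A"
  shows contract_hom: "contract K N \<chi> \<in> module_hom K (tensor K A N) N"
    and contract_pure: "a \<in> carrier A \<Longrightarrow> n \<in> carrier N \<Longrightarrow>
      contract K N \<chi> (pure_tensor K A N a n) = \<chi> a \<odot>\<^bsub>N\<^esub> n"
proof -
  interpret N: module K N by fact
  note \<chi>D = module_hom_D[OF \<chi>[unfolded linear_dual_def], simplified]
  have bil: "bilinear_map K A N N (\<lambda>a n. \<chi> a \<odot>\<^bsub>N\<^esub> n)"
    by (intro bilinear_mapI module_homI)
      (simp_all add: \<chi>D N.smult_l_distr N.smult_r_distr N.smult_assoc1 N.R.m_comm flip: N.smult_assoc1)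
  show "contract K N \<chi> \<in> module_hom K (tensor K A N) N"
    by (rule tensor_lift_hom[OF A N N bil])
  show "a \<in> carrier A \<Longrightarrow> n \<in> carrier N \<Longrightarrow>
      contract K N \<chi> (pure_tensor K A N a n) = \<chi> a \<odot>\<^bsub>N\<^esub> n"
    by (rule tensor_lift_pure[OF A N N bil])
qed

text \<open>On a pure tensor, \<open>\<psi>\<close> pulls out the scalar \<open>\<chi> a\<close>. At
  \<open>x = \<Delta> c\<close> the right side is the convolution of \<open>\<chi>\<close> and
  \<open>\<psi>\<close>, which is how convolution gets related to the map \<open>P\<close>.\<close>

lemma linear_dual_contract:
  assumes A: "module K A" and B: "module K B"
    and \<chi>: "\<chi> \<in> linear_dual K A" and \<psi>: "\<psi> \<in> linear_dual K B"
    and x: "x \<in> carrier (tensor K A B)"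
  shows "\<psi> (contract K B \<chi> x) = tensor_lift K (scalar_module K) (\<lambda>a b. \<chi> a \<otimes>\<^bsub>K\<^esub> \<psi> b) x"
proof -
  interpret A: module K A by fact
  interpret B: module K B by fact
  have S: "module K (scalar_module K)" by (rule A.R.scalar_module_module)
  note \<psi>hom = \<psi>[unfolded linear_dual_def]
  note \<chi>D = module_hom_D[OF \<chi>[unfolded linear_dual_def], simplified] and \<psi>D = module_hom_D[OF \<psi>hom, simplified]
  have bil: "bilinear_map K A B (scalar_module K) (\<lambda>a b. \<chi> a \<otimes>\<^bsub>K\<^esub> \<psi> b)"
    by (intro bilinear_mapI module_homI)
      (simp_all add: \<chi>D \<psi>D A.R.l_distr A.R.r_distr A.R.m_ac)
  show ?thesis
    by (rule tensor_hom_eqI[OF A B S module_hom_comp[OF contract_hom[OF A B \<chi>] \<psi>hom]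
          tensor_lift_hom[OF A B S bil] _ x])
      (simp add: contract_pure[OF A B \<chi>] tensor_lift_pure[OF A B S bil] \<chi>D \<psi>D)
qed

section \<open>Contracting the coassociativity of the coaction\<close>

context left_comodule
begin

lemma coaction_contract:
  assumes \<chi>: "\<chi> \<in> linear_dual K C" and m: "m \<in> carrier M"
  shows "tensor_map K C M (\<lambda>c. contract K C \<chi> (\<Delta> c)) (\<lambda>x. x) (\<rho> m) = \<rho> (contract K M \<chi> (\<rho> m))"
proof -
  let ?CM = "tensor K C M" and ?CC = "tensor K C C"
  let ?P = "\<lambda>c. contract K C \<chi> (\<Delta> c)"
  have C: "module K C" and M: "module K M" by unfold_locales
  have CM: "module K ?CM" and CC: "module K ?CC"
    by (rule tensor_module[OF C M], rule tensor_module[OF C C])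
  have \<rho>m: "\<rho> m \<in> carrier ?CM" by (rule module_hom_D(1)[OF coaction_linear m])
  \<comment> \<open>The map \<open>\<chi> \<otimes> id \<otimes> id\<close> is the contraction of C
    against the whole module \<open>?CM\<close>.\<close>
  note \<Phi> = contract_hom[OF C CM \<chi>]
  note P = module_hom_comp[OF comult_linear contract_hom[OF C C \<chi>]]
  note \<Delta>id = tensor_map_hom_pure[OF C M CC M comult_linear module_hom_id]
  note id\<rho> = tensor_map_hom_pure[OF C M C CM module_hom_id coaction_linear]
  note Pid = tensor_map_hom_pure[OF C M C M P module_hom_id]
  note assoc = tensor_assoc_hom_pure[OF C C M]
  \<comment> \<open>The \<open>id \<otimes> \<rho>\<close> side of coassociativity: on a pure tensor
    of \<open>c\<close> and \<open>n\<close>, both expressions equal \<open>\<chi> c\<close> times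
    \<open>\<rho> n\<close>, by linearity of \<open>\<rho>\<close>.\<close>
  have right: "contract K ?CM \<chi> (tensor_map K C ?CM (\<lambda>x. x) \<rho> (\<rho> m)) = \<rho> (contract K M \<chi> (\<rho> m))"
  proof (rule tensor_hom_eqI[OF C M CM module_hom_comp[OF id\<rho>(1) \<Phi>]
        module_hom_comp[OF contract_hom[OF C M \<chi>] coaction_linear] _ \<rho>m])
    fix c n assume c: "c \<in> carrier C" and n: "n \<in> carrier M"
    have "\<chi> c \<in> carrier K"
      using module_hom_D(1)[OF \<chi>[unfolded linear_dual_def] c] by simp
    then show "contract K ?CM \<chi> (tensor_map K C ?CM (\<lambda>x. x) \<rho> (pure_tensor K C M c n))
        = \<rho> (contract K M \<chi> (pure_tensor K C M c n))"
      using c n by (simp add: id\<rho>(2) contract_pure[OF C CM \<chi>] contract_pure[OF C M \<chi>]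
          module_hom_D[OF coaction_linear])
  qed
  \<comment> \<open>On the \<open>\<Delta> \<otimes> id\<close> side the first leg is some
    \<open>\<Delta> c\<close>, in general not pure, so the associator cannot be evaluated directly.
    For fixed \<open>n\<close> both sides are linear in \<open>x\<close>, and on a pure
    \<open>x\<close> the scalar \<open>\<chi> a\<close> moves into the first leg.\<close>
  have slice: "contract K ?CM \<chi> (tensor_assoc K C C M (pure_tensor K ?CC M x n))
      = pure_tensor K C M (contract K C \<chi> x) n"
    if x: "x \<in> carrier ?CC" and n: "n \<in> carrier M" for x n
  proof (rule tensor_hom_eqI[OF C C CM
        module_hom_comp[OF module_hom_comp[OF pure_tensor_hom(2)[OF CC M n] assoc(1)] \<Phi>]
        module_hom_comp[OF contract_hom[OF C C \<chi>] pure_tensor_hom(2)[OF C M n]] _ x])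
    fix a b assume a: "a \<in> carrier C" and b: "b \<in> carrier C"
    have "\<chi> a \<in> carrier K"
      using module_hom_D(1)[OF \<chi>[unfolded linear_dual_def] a] by simp
    then show "contract K ?CM \<chi> (tensor_assoc K C C M (pure_tensor K ?CC M (pure_tensor K C C a b) n))
        = pure_tensor K C M (contract K C \<chi> (pure_tensor K C C a b)) n"
      using a b n by (simp add: assoc(2) contract_pure[OF C CM \<chi>] contract_pure[OF C C \<chi>]
          pure_tensor_closed[OF C M] module_hom_D(3)[OF pure_tensor_hom(2)[OF C M n]])
  qed
  \<comment> \<open>On a pure tensor of \<open>c\<close> and \<open>n\<close>, this is
    \<open>slice\<close> at \<open>x = \<Delta> c\<close>.\<close>
  have "tensor_map K C M ?P (\<lambda>x. x) (\<rho> m)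
      = contract K ?CM \<chi> (tensor_assoc K C C M (tensor_map K ?CC M \<Delta> (\<lambda>x. x) (\<rho> m)))"
    by (rule tensor_hom_eqI[OF C M CM Pid(1)
          module_hom_comp[OF module_hom_comp[OF \<Delta>id(1) assoc(1)] \<Phi>] _ \<rho>m])
      (simp add: Pid(2) \<Delta>id(2) slice module_hom_D(1)[OF comult_linear])
  also have "\<dots> = \<rho> (contract K M \<chi> (\<rho> m))"
    by (simp add: coaction_coassoc[OF m] right)
  finally show ?thesis .
qed

end

section \<open>Idempotence and the Rota-Baxter identity\<close>

theorem proposition4p1:
  fixes K :: "('k, 'r) ring_scheme"
    and C :: "('k, 'c, 's) module_scheme"
    and M :: "('k, 'm, 't) module_scheme"
    and \<Delta> :: "'c \<Rightarrow> ('c \<times> 'c \<Rightarrow> 'k) set"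
    and \<epsilon> \<chi> :: "'c \<Rightarrow> 'k"
    and \<rho> :: "'m \<Rightarrow> ('c \<times> 'm \<Rightarrow> 'k) set"
    and T :: "'m \<Rightarrow> 'm" and P :: "'c \<Rightarrow> 'c"
  assumes "field K"
    and "coalgebra K C \<Delta> \<epsilon>"
    and "left_comodule K C \<Delta> \<epsilon> M \<rho>"
    and "\<chi> \<in> linear_dual K C"
    and "\<forall>m\<in>carrier M. T m = tensor_lift K M (\<lambda>c n. \<chi> c \<odot>\<^bsub>M\<^esub> n) (\<rho> m)"
    and "\<forall>c\<in>carrier C. P c = tensor_lift K C (\<lambda>a b. \<chi> a \<odot>\<^bsub>C\<^esub> b) (\<Delta> c)"
    and "\<forall>c\<in>carrier C. convolution K \<Delta> \<chi> \<chi> c = \<chi> c"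
  shows "rota_baxter_paired_comodule K C \<Delta> \<epsilon> M \<rho> P T (\<ominus>\<^bsub>K\<^esub> \<one>\<^bsub>K\<^esub>)"
proof -
  interpret left_comodule K C \<Delta> \<epsilon> M \<rho> by fact
  note \<chi> = assms(4)
  let ?CM = "tensor K C M"
  have C: "module K C" and M: "module K M" by unfold_locales
  have CM: "module K ?CM" by (rule tensor_module[OF C M])
  interpret CM: module K ?CM by (rule CM)
  have P_eq: "P c = contract K C \<chi> (\<Delta> c)" if "c \<in> carrier C" for c using assms(6) that by blast
  have T_eq: "T m = contract K M \<chi> (\<rho> m)" if "m \<in> carrier M" for m using assms(5) that by blast
  note P0 = module_hom_comp[OF comult_linear contract_hom[OF C C \<chi>]]
  have P: "P \<in> module_hom K C C"
    by (rule module_hom_cong[OF P0 C P_eq])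
  have T: "T \<in> module_hom K M M"
    by (rule module_hom_cong[OF module_hom_comp[OF coaction_linear contract_hom[OF C M \<chi>]] M T_eq])
  note Pid = tensor_map_hom_pure[OF C M C M P module_hom_id]
  note idT = tensor_map_hom_pure[OF C M C M module_hom_id T]
  note PT = tensor_map_hom_pure[OF C M C M P T]
  have \<rho>: "\<rho> m \<in> carrier ?CM" if "m \<in> carrier M" for m
    by (rule module_hom_D(1)[OF coaction_linear that])
  have Tc: "T m \<in> carrier M" if "m \<in> carrier M" for m by (rule module_hom_D(1)[OF T that])
  \<comment> \<open>\<open>P\<close> is known to agree with its formula only on the carrier, so the
    two tensor maps are compared on pure tensors instead of rewriting \<open>P\<close> as a
    function.\<close>
  have \<rho>T: "tensor_map K C M P (\<lambda>x. x) (\<rho> m) = \<rho> (T m)" if m: "m \<in> carrier M" for m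
  proof -
    have "tensor_map K C M P (\<lambda>x. x) (\<rho> m)
        = tensor_map K C M (\<lambda>c. contract K C \<chi> (\<Delta> c)) (\<lambda>x. x) (\<rho> m)"
      by (rule tensor_hom_eqI[OF C M CM Pid(1) tensor_map_hom[OF C M C M P0 module_hom_id] _ \<rho>[OF m]])
        (simp add: Pid(2) tensor_map_pure[OF C M C M P0 module_hom_id] P_eq)
    then show ?thesis by (simp add: coaction_contract[OF \<chi> m] T_eq m)
  qed
  \<comment> \<open>With \<open>\<psi> = \<chi>\<close>, the left side becomes the convolution
    square of \<open>\<chi>\<close> at \<open>c\<close>; this is where idempotence enters.\<close>
  have \<chi>P: "\<chi> (P c) = \<chi> c" if "c \<in> carrier C" for c
    using linear_dual_contract[OF C C \<chi> \<chi> module_hom_D(1)[OF comult_linear that]] assms(7) that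
    by (simp add: P_eq convolution_def)
  have TT: "T (T m) = T m" if m: "m \<in> carrier M" for m
  proof -
    have "T (T m) = contract K M \<chi> (tensor_map K C M P (\<lambda>x. x) (\<rho> m))"
      by (simp add: \<rho>T m T_eq[OF Tc])
    \<comment> \<open>Contracting after \<open>P \<otimes> id\<close> is contracting with
      \<open>\<chi>\<close> composed with \<open>P\<close>, which is \<open>\<chi>\<close>
      again.\<close>
    also have "\<dots> = contract K M \<chi> (\<rho> m)"
      by (rule tensor_hom_eqI[OF C M M module_hom_comp[OF Pid(1) contract_hom[OF C M \<chi>]]
            contract_hom[OF C M \<chi>] _ \<rho>[OF m]])
        (simp add: Pid(2) contract_pure[OF C M \<chi>] module_hom_D(1)[OF P] \<chi>P)
    finally show ?thesis by (simp add: T_eq m)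
  qed
  show ?thesis
  proof unfold_locales
    fix m assume m: "m \<in> carrier M"
    \<comment> \<open>\<open>P \<otimes> T\<close> is split as
      \<open>(id \<otimes> T)(P \<otimes> id)\<close> so that \<open>\<rho>T\<close> applies to the
      inner factor.\<close>
    have "tensor_map K C M P T (\<rho> m)
        = tensor_map K C M (\<lambda>x. x) T (tensor_map K C M P (\<lambda>x. x) (\<rho> m))"
      by (rule tensor_hom_eqI[OF C M CM PT(1) module_hom_comp[OF Pid(1) idT(1)] _ \<rho>[OF m]])
        (simp add: PT(2) Pid(2) idT(2) module_hom_D(1)[OF P])
    also have "\<dots> = tensor_map K C M (\<lambda>x. x) T (\<rho> (T m))" by (simp add: \<rho>T m)
    \<comment> \<open>Adding and subtracting \<open>\<rho> (T m)\<close> creates the two terms still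
      missing from the identity.\<close>
    also have "\<dots> = \<rho> (T m) \<oplus>\<^bsub>?CM\<^esub> tensor_map K C M (\<lambda>x. x) T (\<rho> (T m)) \<oplus>\<^bsub>?CM\<^esub> (\<ominus>\<^bsub>?CM\<^esub> \<rho> (T m))"
      using \<rho>[OF Tc[OF m]] module_hom_D(1)[OF idT(1) \<rho>[OF Tc[OF m]]]
      by (metis CM.M.a_comm CM.M.a_inv_closed CM.M.a_assoc CM.M.r_neg CM.M.r_zero CM.M.a_closed)
    \<comment> \<open>By \<open>\<rho>T\<close> at \<open>T m\<close> and \<open>TT\<close>, the
      first summand is \<open>\<rho> (T m)\<close>; the weight acts on the last one as
      negation.\<close>
    finally show "tensor_map K C M P T (\<rho> m) =
        tensor_map K C M P (\<lambda>x. x) (\<rho> (T m)) \<oplus>\<^bsub>?CM\<^esub> tensor_map K C M (\<lambda>x. x) T (\<rho> (T m))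
        \<oplus>\<^bsub>?CM\<^esub> (\<ominus>\<^bsub>K\<^esub> \<one>\<^bsub>K\<^esub>) \<odot>\<^bsub>?CM\<^esub> \<rho> (T m)"
      by (simp add: \<rho>T TT Tc m CM.smult_l_minus \<rho>)
  qed (use P T in simp_all)
qed

end
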